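(* Let $T$ be the set of $n\in\mathbb{N}$ whose binary expansion contains an even number of digits $1$ (so $T=\{0,3,5,6,9,10,12,15,\dots\}$), and let $\bar T$ be its reciprocal. Then \[ \bar T=\{0\}\cup\{4k\pm1: k\ge1 \text{ and the binary expansion of } k \text{ ends in an even number of } 0\text{s}\}, \] where the number of trailing zeros of $k$ is allowed to be $0$. Consequently, $\delta(\bar T)=1/3$.
   Context: $\mathbb{N}=\{0,1,2,\dots\}$. For $A\subseteq\mathbb{N}$ with $0\in A$, the reciprocal $\bar A$ is the unique set $B\subseteq\mathbb{N}$ with $\big(\sum_{a\in A}q^a\big)\big(\sum_{b\in B}q^b\big)=1$ in $\mathbb{F}_2[[q]]$. For $B\subseteq\mathbb{N}$, $\delta(B)=\lim_{n\to\infty}|B\cap[0,n]|/(n+1)$. *)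

theory Defs
  imports Complex_Main "HOL-Library.Z2" "HOL-Computational_Algebra.Formal_Power_Series"
begin

text \<open>The coefficient field \<open>\<F>\<^sub>2\<close> is the type \<^typ>\<open>bit\<close>. It is unrelated to the constant
  \<^term>\<open>bit n i\<close>, which states that the binary digit of \<open>n\<close> at \<open>2 ^ i\<close> is \<open>1\<close>.\<close>

definition set_fps :: "nat set \<Rightarrow> bit fps" where
  "set_fps A = Abs_fps (\<lambda>n. of_bool (n \<in> A))"

definition reciprocal :: "nat set \<Rightarrow> nat set" where
  "reciprocal A = (THE B. set_fps A * set_fps B = 1)"

lemma set_fps_nth_neq_zero: "set_fps {n. fps_nth f n \<noteq> 0} = f"
  by (rule fps_ext) (auto simp: set_fps_def)

lemma set_fps_eq_iff: "set_fps A = set_fps B \<longleftrightarrow> A = B"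
  by (auto simp: set_fps_def fps_eq_iff of_bool_def split: if_splits)

lemma ex1_reciprocal:
  assumes "0 \<in> A"
  shows "\<exists>!B. set_fps A * set_fps B = 1"
proof -
  have nz: "fps_nth (set_fps A) 0 \<noteq> 0"
    using assms by (simp add: set_fps_def)
  show ?thesis
  proof (rule ex1I)
    show "set_fps A * set_fps {n. fps_nth (inverse (set_fps A)) n \<noteq> 0} = 1"
      unfolding set_fps_nth_neq_zero by (rule inverse_mult_eq_1' [OF nz])
  next
    fix B assume "set_fps A * set_fps B = 1"
    then have "inverse (set_fps A) = set_fps B"
      by (rule fps_inverse_unique)
    then have "set_fps B = set_fps {n. fps_nth (inverse (set_fps A)) n \<noteq> 0}"
      unfolding set_fps_nth_neq_zero by (rule sym)
    then show "B = {n. fps_nth (inverse (set_fps A)) n \<noteq> 0}"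
      unfolding set_fps_eq_iff .
  qed
qed

text \<open>\<open>\<delta>(B) = d\<close>, including the existence of the limit.\<close>

definition has_density :: "nat set \<Rightarrow> real \<Rightarrow> bool" where
  "has_density B d \<longleftrightarrow> (\<lambda>n. real (card (B \<inter> {0..n})) / real (n + 1)) \<longlonglongrightarrow> d"

definition even_ones_set :: "nat set" where
  "even_ones_set = {n. even (card {i. bit n i})}"

text \<open>Counts the digit positions at and below which all digits are \<open>0\<close>; meaningful only for
  \<open>k \<ge> 1\<close>, since for \<open>k = 0\<close> the set is infinite.\<close>

definition trailing_zeros :: "nat \<Rightarrow> nat" where
  "trailing_zeros k = card {i. \<forall>j\<le>i. \<not> bit k j}"

end

theory Submission
  imports Defs "HOL-Real_Asymp.Real_Asymp"
begin

text \<open>Let \<open>F\<close> be the series of \<open>T\<close>. Squaring a series over \<open>\<F>\<^sub>2\<close> is the substitution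
  \<open>q \<mapsto> q\<^sup>2\<close>, so the rules \<open>2n \<in> T \<longleftrightarrow> n \<in> T\<close> and
  \<open>2n + 1 \<in> T \<longleftrightarrow> n \<notin> T\<close> become
  \<open>F = (1 + q) F\<^sup>2 + q / (1 + q\<^sup>2)\<close>. Hence \<open>1 / F\<close> is a root of
  \<open>(1 + q\<^sup>2) Y = (1 + q\<^sup>2) (1 + q) + q Y\<^sup>2\<close>, which has only one root since \<open>1 + q\<^sup>2 - q Z\<close>
  is nonzero for every \<open>Z\<close>. The series of the claimed set is a root as well.

  For the density, the number \<open>c(m)\<close> of admissible \<open>k \<le> m\<close> satisfies
  \<open>c(m) = m - c(\<lfloor>m/2\<rfloor>)\<close>, so \<open>3 c(m) - 2 m\<close> is of logarithmic size.\<close>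

section \<open>Binary digits under doubling\<close>

lemma finite_bits_nat: "finite {i. bit (n::nat) i}"
proof (rule finite_subset)
  show "{i. bit n i} \<subseteq> {..n}"
  proof
    fix i assume "i \<in> {i. bit n i}"
    then have "n div 2 ^ i \<noteq> 0"
      by (auto simp: bit_iff_odd intro: ccontr)
    then have "2 ^ i \<le> n"
      by (simp add: div_eq_0_iff)
    then show "i \<in> {..n}"
      by (simp add: less_imp_le[OF less_le_trans[OF less_exp]])
  qed
qed simp

lemma bits_double: "{i. bit (2 * n :: nat) i} = Suc ` {i. bit n i}"
proof (rule set_eqI)
  fix i show "i \<in> {i. bit (2 * n) i} \<longleftrightarrow> i \<in> Suc ` {i. bit n i}"
    by (cases i) (auto simp: bit_0 bit_Suc)
qed

lemma bits_Suc_double: "{i. bit (Suc (2 * n)) i} = insert 0 (Suc ` {i. bit n i})"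
proof (rule set_eqI)
  fix i show "i \<in> {i. bit (Suc (2 * n)) i} \<longleftrightarrow> i \<in> insert 0 (Suc ` {i. bit n i})"
    by (cases i) (auto simp: bit_0 bit_Suc)
qed

lemma even_ones_set_double: "2 * n \<in> even_ones_set \<longleftrightarrow> n \<in> even_ones_set"
  by (simp add: even_ones_set_def bits_double card_image)

lemma even_ones_set_Suc_double: "Suc (2 * n) \<in> even_ones_set \<longleftrightarrow> n \<notin> even_ones_set"
  by (simp add: even_ones_set_def bits_Suc_double card_image finite_bits_nat)

lemma trailing_zeros_odd: "trailing_zeros (Suc (2 * k)) = 0"
proof -
  have "{i. \<forall>j\<le>i. \<not> bit (Suc (2 * k)) j} = {}"
    by (auto simp: bit_0 intro!: exI[of _ 0])
  then show ?thesis
    unfolding trailing_zeros_def by (simp only: card.empty)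
qed

lemma trailing_zeros_double:
  assumes "k \<ge> 1"
  shows "trailing_zeros (2 * k) = Suc (trailing_zeros k)"
proof -
  let ?Z = "\<lambda>k::nat. {i. \<forall>j\<le>i. \<not> bit k j}"
  \<comment> \<open>A digit 1 of \<open>k\<close> bounds the trailing zero positions. Finiteness
    matters because \<open>card\<close> of an infinite set is 0, so inserting a position would not
    add 1.\<close>
  obtain b where b: "bit k b"
    using assms bit_eqI[of k 0] by auto
  then have "?Z k \<subseteq> {..b}"
    by (auto simp: not_le[symmetric] intro: ccontr)
  then have fin: "finite (?Z k)"
    by (rule finite_subset) simp
  have "?Z (2 * k) = insert 0 (Suc ` ?Z k)"
  proof (rule set_eqI)
    fix i
    \<comment> \<open>The last digit of \<open>2 * k\<close> is 0, so splitting off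
      \<open>j = 0\<close> leaves the same condition shifted by one position.\<close>
    have "(\<forall>j\<le>Suc i. \<not> bit (2 * k) j) \<longleftrightarrow> (\<forall>j\<le>i. \<not> bit k j)" for i
      unfolding less_Suc_eq_le[symmetric] All_less_Suc2 by (simp add: bit_0 bit_Suc)
    then show "i \<in> ?Z (2 * k) \<longleftrightarrow> i \<in> insert 0 (Suc ` ?Z k)"
      by (cases i) (auto simp: bit_0)
  qed
  then show ?thesis
    using fin by (simp add: trailing_zeros_def card_image)
qed

section \<open>Squaring in characteristic 2 and the equation for the given set\<close>

text \<open>In the Cauchy product the terms at \<open>i\<close> and \<open>n - i\<close> agree and
  cancel in characteristic 2. Only the middle term survives, and it is its own square root since
  \<open>x * x = x\<close>.\<close>

lemma bit_fps_square_nth: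
  fixes f :: "bit fps"
  shows "fps_nth (f\<^sup>2) n = of_bool (even n) * fps_nth f (n div 2)"
proof -
  let ?g = "\<lambda>i. fps_nth f i * fps_nth f (n - i)"
  have sq: "x * x = x" for x :: bit
    by (cases x) auto
  have refl: "(\<Sum>i | i \<le> n \<and> n < 2 * i. ?g i) = (\<Sum>i | 2 * i < n. ?g i)"
    by (rule sum.reindex_bij_witness[where i = "\<lambda>i. n - i" and j = "\<lambda>i. n - i"])
      (auto simp: mult.commute)
  have split: "{0..n} = {i. 2 * i < n} \<union> {i. i \<le> n \<and> n < 2 * i} \<union> {i. 2 * i = n}"
    by auto
  have fin: "finite {i. 2 * i < n}" "finite {i. i \<le> n \<and> n < 2 * i}" "finite {i. 2 * i = n}"
    by (auto intro: finite_subset[of _ "{..n}"])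
  have "fps_nth (f\<^sup>2) n = (\<Sum>i | 2 * i < n. ?g i) + (\<Sum>i | i \<le> n \<and> n < 2 * i. ?g i)
      + (\<Sum>i | 2 * i = n. ?g i)"
    unfolding power2_eq_square fps_mult_nth split using fin
    by (subst sum.union_disjoint; (subst sum.union_disjoint)?) force+
  also have "\<dots> = (\<Sum>i | 2 * i = n. ?g i)"
    unfolding refl by simp
  also have "\<dots> = of_bool (even n) * fps_nth f (n div 2)"
  proof (cases "even n")
    case True
    then have "{i. 2 * i = n} = {n div 2}"
      by auto
    with True show ?thesis
      by (auto simp: sq elim!: evenE)
  next
    case False
    then have "{i. 2 * i = n} = {}"
      by auto
    with False show ?thesis
      by simp
  qed
  finally show ?thesis .
qed

lemma set_fps_nth: "fps_nth (set_fps A) n = of_bool (n \<in> A)"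
  by (simp add: set_fps_def)

lemma even_ones_fps_eq:
  defines "F \<equiv> set_fps even_ones_set"
  shows "(1 + fps_X\<^sup>2) * F = (1 + fps_X\<^sup>2) * (1 + fps_X) * F\<^sup>2 + fps_X"
proof -
  \<comment> \<open>\<open>W\<close> is the inverse of \<open>1 + fps_X\<^sup>2\<close>; the signs
    of the geometric series vanish. \<open>fps_X * W\<close> supplies the 1 that negates membership
    at odd indices.\<close>
  define W :: "bit fps" where "W = Abs_fps (\<lambda>n. of_bool (even n))"
  have W: "(1 + fps_X\<^sup>2) * W = 1"
    by (rule fps_ext) (auto simp: W_def distrib_right fps_X_power_mult_nth)
  have F: "F = (1 + fps_X) * F\<^sup>2 + fps_X * W"
  proof (rule fps_ext)
    fix n
    show "fps_nth F n = fps_nth ((1 + fps_X) * F\<^sup>2 + fps_X * W) n"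
    proof (cases "even n")
      case True
      then obtain m where "n = 2 * m" by (elim evenE)
      then show ?thesis
        using even_ones_set_double[of m]
        by (cases m) (simp_all add: F_def W_def distrib_right bit_fps_square_nth set_fps_nth)
    next
      case False
      then obtain m where "n = Suc (2 * m)" by (auto elim: oddE)
      then show ?thesis
        by (simp add: F_def W_def distrib_right bit_fps_square_nth set_fps_nth
            even_ones_set_Suc_double)
    qed
  qed
  have "(1 + fps_X\<^sup>2) * F =
      (1 + fps_X\<^sup>2) * (1 + fps_X) * F\<^sup>2 + fps_X * ((1 + fps_X\<^sup>2) * W)"
    by (subst F) (simp add: algebra_simps)
  then show ?thesis
    by (simp add: W)
qed

section \<open>The claimed set and its equation\<close>

text \<open>The bound excludes 0, whose value under \<open>trailing_zeros\<close> is
  \<open>card\<close> of an infinite set, hence 0 and even.\<close>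

definition even_tz :: "nat \<Rightarrow> bool" where
  "even_tz k \<longleftrightarrow> k \<ge> 1 \<and> even (trailing_zeros k)"

lemma even_tz_0: "\<not> even_tz 0"
  by (simp add: even_tz_def)

lemma even_tz_odd: "even_tz (Suc (2 * k))"
  by (simp add: even_tz_def trailing_zeros_odd)

lemma even_tz_double: "k \<ge> 1 \<Longrightarrow> even_tz (2 * k) \<longleftrightarrow> \<not> even_tz k"
  by (simp add: even_tz_def trailing_zeros_double)

definition recip_set :: "nat set" where
  "recip_set = {0} \<union> {n. \<exists>k\<ge>1. even (trailing_zeros k) \<and> (n = 4 * k - 1 \<or> n = 4 * k + 1)}"

lemma zero_in_recip_set: "0 \<in> recip_set"
  by (simp add: recip_set_def)

lemma recip_set_even: "m \<ge> 1 \<Longrightarrow> 2 * m \<notin> recip_set"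
  unfolding recip_set_def by (auto; presburger)

lemma recip_set_1_mod_4: "4 * k + 1 \<in> recip_set \<longleftrightarrow> even_tz k"
proof -
  have "4 * k + 1 = 4 * j - 1 \<or> 4 * k + 1 = 4 * j + 1 \<longleftrightarrow> j = k" if "j \<ge> 1" for j
    using that by presburger
  then show ?thesis
    unfolding recip_set_def even_tz_def by auto
qed

lemma recip_set_3_mod_4: "4 * k + 3 \<in> recip_set \<longleftrightarrow> even_tz (Suc k)"
proof -
  have "4 * k + 3 = 4 * j - 1 \<or> 4 * k + 3 = 4 * j + 1 \<longleftrightarrow> j = Suc k" if "j \<ge> 1" for j
    using that by presburger
  then show ?thesis
    unfolding recip_set_def even_tz_def by auto
qed

text \<open>This is the comparison of coefficients at \<open>4 * k + 3\<close> in
  \<open>recip_fps_eq\<close>; the case \<open>k = 0\<close> differs by the term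
  \<open>fps_X ^ 3\<close>. One of \<open>k\<close> and \<open>k + 1\<close> is odd and so satisfies
  \<open>even_tz\<close>; the other is even, and halving it negates \<open>even_tz\<close> unless it
  is 0.\<close>

lemma recip_set_rec:
  "(4 * k + 3 \<in> recip_set \<longleftrightarrow> 4 * k + 1 \<in> recip_set) \<longleftrightarrow> k \<ge> 1 \<and> 2 * k + 1 \<notin> recip_set
     \<or> k = 0 \<and> 2 * k + 1 \<in> recip_set"
proof (cases "even k")
  case True
  then obtain j where j: "k = 2 * j" by (elim evenE)
  have "even_tz (Suc k)" "2 * k + 1 \<in> recip_set \<longleftrightarrow> even_tz j"
    using even_tz_odd[of j] recip_set_1_mod_4[of j] by (simp_all add: j)
  moreover have "even_tz k \<longleftrightarrow> j \<ge> 1 \<and> \<not> even_tz j"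
    using even_tz_double[of j] even_tz_0 by (cases j) (auto simp: j)
  ultimately show ?thesis
    unfolding recip_set_1_mod_4 recip_set_3_mod_4 using even_tz_0 by (cases j) (auto simp: j)
next
  case False
  then obtain j where j: "k = Suc (2 * j)" by (auto elim: oddE)
  have "even_tz k" "2 * k + 1 \<in> recip_set \<longleftrightarrow> even_tz (Suc j)"
    using even_tz_odd[of j] recip_set_3_mod_4[of j] by (simp_all add: j numeral_3_eq_3)
  moreover have "even_tz (Suc k) \<longleftrightarrow> \<not> even_tz (Suc j)"
    using even_tz_double[of "Suc j"] by (simp add: j)
  ultimately show ?thesis
    unfolding recip_set_1_mod_4 recip_set_3_mod_4 by (simp add: j)
qed

lemma recip_fps_eq:
  defines "S \<equiv> set_fps recip_set"
  shows "(1 + fps_X\<^sup>2) * S = (1 + fps_X\<^sup>2) * (1 + fps_X) + fps_X * S\<^sup>2"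
proof (rule fps_ext)
  fix n
  have poly: "(1 + fps_X\<^sup>2) * (1 + fps_X) = 1 + fps_X + fps_X\<^sup>2 + (fps_X ^ 3 :: bit fps)"
    by (simp add: algebra_simps power2_eq_square power3_eq_cube)
  have lhs: "fps_nth ((1 + fps_X\<^sup>2) * S) n =
      fps_nth S n + (if n < 2 then 0 else fps_nth S (n - 2))"
    by (simp add: distrib_right fps_X_power_mult_nth)
  have rhs: "fps_nth ((1 + fps_X\<^sup>2) * (1 + fps_X) + fps_X * S\<^sup>2) n =
      of_bool (n < 4) + (if odd n then fps_nth S (n div 2) else 0)"
    unfolding poly by (auto simp: bit_fps_square_nth fps_X_power_nth elim: oddE)
  consider m where "n = 2 * m" | k where "n = 4 * k + 1" | k where "n = 4 * k + 3"
  proof -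
    assume *: "\<And>m. n = 2 * m \<Longrightarrow> thesis" "\<And>k. n = 4 * k + 1 \<Longrightarrow> thesis"
      "\<And>k. n = 4 * k + 3 \<Longrightarrow> thesis"
    have "n = 2 * (n div 2) \<or> n = 4 * (n div 4) + 1 \<or> n = 4 * (n div 4) + 3"
      by presburger
    then show thesis using * by blast
  qed
  then show "fps_nth ((1 + fps_X\<^sup>2) * S) n =
      fps_nth ((1 + fps_X\<^sup>2) * (1 + fps_X) + fps_X * S\<^sup>2) n"
  proof cases
    case 1
    consider "m = 0" | "m = 1" | "m \<ge> 2" by linarith
    then show ?thesis
      unfolding lhs rhs unfolding S_def set_fps_nth
      using recip_set_even[of m] recip_set_even[of "m - 1"]
      by cases (auto simp: 1 zero_in_recip_set diff_mult_distrib2)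
  next
    case 2
    \<comment> \<open>For \<open>k \<ge> 1\<close> the indices \<open>4 * k + 1\<close> and
      \<open>4 * k - 1\<close> both lie in the set or both outside it, so their coefficients
      cancel.\<close>
    have "n div 2 = 2 * k" "k \<ge> 1 \<Longrightarrow> n - 2 = 4 * (k - 1) + 3"
      using 2 by linarith+
    then show ?thesis
      unfolding lhs rhs unfolding S_def set_fps_nth
      using recip_set_1_mod_4[of k] recip_set_3_mod_4[of "k - 1"] recip_set_even[of k]
      by (cases "k = 0") (simp_all add: 2 zero_in_recip_set even_tz_0)
  next
    case 3
    have "n div 2 = 2 * k + 1" "n - 2 = 4 * k + 1"
      using 3 by linarith+
    then show ?thesis
      unfolding lhs rhs unfolding S_def set_fps_nth
      using recip_set_rec[of k] by (auto simp: 3)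
  qed
qed

section \<open>Uniqueness of the root and the reciprocal\<close>

text \<open>Subtracting the equations gives a product with factor \<open>P - S\<close>. The other
  factor has constant term 1, and power series over an integral domain have no zero
  divisors.\<close>

lemma fps_quadratic_unique:
  fixes P S A :: "'a::idom fps"
  assumes P: "(1 + fps_X\<^sup>2) * P = A + fps_X * P\<^sup>2"
    and S: "(1 + fps_X\<^sup>2) * S = A + fps_X * S\<^sup>2"
  shows "P = S"
proof -
  have "(P - S) * (1 + fps_X\<^sup>2 - fps_X * (P + S)) =
      ((1 + fps_X\<^sup>2) * P - fps_X * P\<^sup>2) - ((1 + fps_X\<^sup>2) * S - fps_X * S\<^sup>2)"
    by (simp add: algebra_simps power2_eq_square)
  also have "\<dots> = 0"
    unfolding P S by simp
  finally have "P - S = 0 \<or> 1 + fps_X\<^sup>2 - fps_X * (P + S) = 0"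
    by simp
  moreover have "fps_nth (1 + fps_X\<^sup>2 - fps_X * (P + S)) 0 \<noteq> 0"
    by simp
  ultimately show ?thesis
    by (metis eq_iff_diff_eq_0 fps_zero_nth)
qed

lemma reciprocal_eqI:
  assumes "0 \<in> A" "set_fps A * set_fps B = 1"
  shows "reciprocal A = B"
  unfolding reciprocal_def using ex1_reciprocal[OF assms(1)] assms(2) by (rule the1_equality)

lemma reciprocal_even_ones_set: "reciprocal even_ones_set = recip_set"
proof (rule reciprocal_eqI)
  show zero: "0 \<in> even_ones_set"
  proof -
    have "{i. bit (0::nat) i} = {}"
      by auto
    then show ?thesis
      unfolding even_ones_set_def mem_Collect_eq by (simp only: card.empty even_zero)
  qed
  let ?F = "set_fps even_ones_set"
  obtain B where B: "?F * set_fps B = 1"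
    using ex1_reciprocal[OF zero] by blast
  let ?P = "set_fps B"
  \<comment> \<open>Multiplying the equation for \<open>?F\<close> by \<open>?P\<^sup>2\<close> and
    using \<open>?F * ?P = 1\<close> turns it into the quadratic equation for
    \<open>?P\<close>.\<close>
  have "(1 + fps_X\<^sup>2) * ?P = ((1 + fps_X\<^sup>2) * ?F) * ?P\<^sup>2"
    using B by (simp add: power2_eq_square mult.assoc[symmetric])
  also have "\<dots> = (1 + fps_X\<^sup>2) * (1 + fps_X) * (?F * ?P)\<^sup>2 + fps_X * ?P\<^sup>2"
    unfolding even_ones_fps_eq by (simp add: algebra_simps power2_eq_square)
  finally have "(1 + fps_X\<^sup>2) * ?P = (1 + fps_X\<^sup>2) * (1 + fps_X) + fps_X * ?P\<^sup>2"
    by (simp add: B)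
  then have "?P = set_fps recip_set"
    using recip_fps_eq by (rule fps_quadratic_unique)
  with B show "?F * set_fps recip_set = 1"
    by simp
qed

section \<open>Counting and density\<close>

definition even_tz_count :: "nat \<Rightarrow> nat" where
  "even_tz_count m = card {k. k \<le> m \<and> even_tz k}"

lemma even_tz_count_0: "even_tz_count 0 = 0"
  by (auto simp: even_tz_count_def even_tz_0)

lemma even_tz_count_Suc:
  "even_tz_count (Suc m) = even_tz_count m + of_bool (even_tz (Suc m))"
proof -
  have "{k. k \<le> Suc m \<and> even_tz k} =
      {k. k \<le> m \<and> even_tz k} \<union> (if even_tz (Suc m) then {Suc m} else {})"
    by (auto simp: le_Suc_eq)
  then show ?thesis
    by (simp add: even_tz_count_def)
qed

text \<open>Going from \<open>m\<close> to \<open>m + 1\<close> adds the odd number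
  \<open>2 * m + 1\<close> to the first count, and exactly one of \<open>2 * m + 2\<close> and
  \<open>m + 1\<close> enters its count.\<close>

lemma even_tz_count_double: "even_tz_count (2 * m) + even_tz_count m = 2 * m"
proof (induction m)
  case (Suc m)
  then show ?case
    using even_tz_odd[of m] even_tz_double[of "Suc m"]
    by (auto simp: even_tz_count_Suc)
qed (simp add: even_tz_count_0)

lemma even_tz_count_rec: "even_tz_count m + even_tz_count (m div 2) = m"
proof (cases "even m")
  case True
  then show ?thesis
    using even_tz_count_double[of "m div 2"] by simp
next
  case False
  then obtain j where "m = Suc (2 * j)" by (auto elim: oddE)
  then show ?thesis
    using even_tz_count_double[of j] even_tz_odd[of j] by (simp add: even_tz_count_Suc)
qed

text \<open>For \<open>m = 0\<close> this uses \<open>log 2 0 = 0\<close>.\<close>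

lemma even_tz_count_bound: "\<bar>3 * real (even_tz_count m) - 2 * real m\<bar> \<le> 1 + log 2 (real m)"
proof (induction m rule: less_induct)
  case (less m)
  consider "m = 0" | "m = 1" | "m \<ge> 2" by linarith
  then show ?case
  proof cases
    case 1
    then show ?thesis by (simp add: even_tz_count_0 log_def)
  next
    case 2
    then show ?thesis using even_tz_count_rec[of 1] by (simp add: even_tz_count_0)
  next
    case 3
    let ?h = "m div 2"
    \<comment> \<open>With \<open>h = m div 2\<close> and \<open>c = even_tz_count\<close>,
      \<open>3 * c m - 2 * m = (m - 2 * h) - (3 * c h - 2 * h)\<close>. Each halving thus costs at
      most 1, while the logarithm drops by at least 1.\<close>
    have rec: "real (even_tz_count m) = real m - real (even_tz_count ?h)"
      using even_tz_count_rec[of m] by linarith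
    have half: "\<bar>real m - 2 * real ?h\<bar> \<le> 1"
      by linarith
    have "log 2 (2 * real ?h) \<le> log 2 (real m)"
      using 3 by (subst log_le_cancel_iff) auto
    then have "1 + log 2 (real ?h) \<le> log 2 (real m)"
      using 3 by (subst (asm) log_mult) auto
    moreover have "\<bar>3 * real (even_tz_count ?h) - 2 * real ?h\<bar> \<le> 1 + log 2 (real ?h)"
      using 3 by (intro less.IH) auto
    ultimately show ?thesis
      using rec half by linarith
  qed
qed

lemma card_recip_set:
  "card (recip_set \<inter> {0..n}) = 1 + even_tz_count ((n + 1) div 4) + even_tz_count ((n - 1) div 4)"
proof -
  let ?K = "\<lambda>m. {k. k \<le> m \<and> even_tz k}"
  let ?A = "(\<lambda>k. 4 * k - 1) ` ?K ((n + 1) div 4)"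
  let ?B = "(\<lambda>k. 4 * k + 1) ` ?K ((n - 1) div 4)"
  have pos: "k \<ge> 1" if "even_tz k" for k
    using that by (simp add: even_tz_def)
  have "recip_set \<inter> {0..n} = {0} \<union> (?A \<union> ?B)"
  proof (rule set_eqI)
    fix x
    \<comment> \<open>At \<open>n = 0\<close> the truncated \<open>n - 1\<close> is 0; the
      equivalence survives because \<open>k \<ge> 1\<close>.\<close>
    have "(x = 4 * k - 1 \<or> x = 4 * k + 1) \<and> x \<le> n \<longleftrightarrow>
        x = 4 * k - 1 \<and> k \<le> (n + 1) div 4 \<or> x = 4 * k + 1 \<and> k \<le> (n - 1) div 4"
      if "k \<ge> 1" for k
    proof -
      have "4 * k - 1 \<le> n \<longleftrightarrow> k \<le> (n + 1) div 4" "4 * k + 1 \<le> n \<longleftrightarrow> k \<le> (n - 1) div 4"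
        using that by (auto simp: less_eq_div_iff_mult_less_eq)
      then show ?thesis
        by blast
    qed
    then have "(\<exists>k. even_tz k \<and> (x = 4 * k - 1 \<or> x = 4 * k + 1) \<and> x \<le> n) \<longleftrightarrow>
        (\<exists>k. even_tz k \<and> (x = 4 * k - 1 \<and> k \<le> (n + 1) div 4 \<or> x = 4 * k + 1 \<and> k \<le> (n - 1) div 4))"
      using pos by metis
    then have "x \<noteq> 0 \<Longrightarrow> x \<in> recip_set \<inter> {0..n} \<longleftrightarrow> x \<in> ?A \<union> ?B"
      unfolding recip_set_def even_tz_def image_def by auto
    then show "x \<in> recip_set \<inter> {0..n} \<longleftrightarrow> x \<in> {0} \<union> (?A \<union> ?B)"
      by (cases "x = 0") (auto simp: zero_in_recip_set)
  qed
  moreover have "?A \<inter> ?B = {}"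
  proof -
    have "4 * j - 1 \<noteq> 4 * k + 1" if "j \<ge> 1" for j k :: nat
      using that by presburger
    then show ?thesis
      using pos by auto
  qed
  moreover have "0 \<notin> ?A \<union> ?B"
    using pos by fastforce
  moreover have "card ?A = even_tz_count ((n + 1) div 4)"
    unfolding even_tz_count_def by (rule card_image) (auto simp: inj_on_def dest!: pos)
  moreover have "card ?B = even_tz_count ((n - 1) div 4)"
    unfolding even_tz_count_def by (rule card_image) (auto simp: inj_on_def)
  moreover have "finite ?A" "finite ?B"
    by auto
  ultimately show ?thesis
    by (simp add: card_Un_disjoint)
qed

lemma card_recip_set_bound:
  "\<bar>real (card (recip_set \<inter> {0..n})) - real (n + 1) / 3\<bar> \<le> 4 + log 2 (real (n + 1))"
proof -
  let ?u = "(n + 1) div 4" and ?v = "(n - 1) div 4"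
  have "log 2 (real m) \<le> log 2 (real (n + 1))" if "m \<le> n + 1" for m
    using that by (cases "m = 0") (auto simp: log_def divide_right_mono)
  from this[of ?u] this[of ?v]
  have "\<bar>3 * real (even_tz_count ?u) - 2 * real ?u\<bar> \<le> 1 + log 2 (real (n + 1))"
    "\<bar>3 * real (even_tz_count ?v) - 2 * real ?v\<bar> \<le> 1 + log 2 (real (n + 1))"
    using even_tz_count_bound[of ?u] even_tz_count_bound[of ?v]
    by (auto simp: div_le_mono2 le_SucI le_trans[OF div_le_dividend])
  \<comment> \<open>Up to rounding, \<open>?u\<close> and \<open>?v\<close> are both
    \<open>n / 4\<close>, so two thirds of their sum is about \<open>n / 3\<close>.\<close>
  moreover have "2 * ?u + 2 * ?v \<le> n + 1" "n \<le> 2 * ?u + 2 * ?v + 4"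
    by linarith+
  then have "2 * real ?u + 2 * real ?v \<le> real n + 1" "real n \<le> 2 * real ?u + 2 * real ?v + 4"
    by linarith+
  moreover have "log 2 (real (n + 1)) \<ge> 0"
    by simp
  ultimately show ?thesis
    unfolding card_recip_set by (simp del: of_nat_div) argo
qed

lemma has_density_recip_set: "has_density recip_set (1 / 3)"
  unfolding has_density_def
proof (rule LIM_zero_cancel, rule tendsto_0_le)
  show "(\<lambda>n. (4 + log 2 (real (n + 1))) / real (n + 1)) \<longlonglongrightarrow> 0"
    by real_asymp
  \<comment> \<open>The trailing factor 1 is the constant demanded by
    \<open>tendsto_0_le\<close>.\<close>
  have "norm (real (card (recip_set \<inter> {0..n})) / real (n + 1) - 1 / 3)
      \<le> norm ((4 + log 2 (real (n + 1))) / real (n + 1)) * 1" for n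
  proof -
    have "real (card (recip_set \<inter> {0..n})) / real (n + 1) - 1 / 3 =
        (real (card (recip_set \<inter> {0..n})) - real (n + 1) / 3) / real (n + 1)"
      by (simp add: diff_divide_distrib)
    then have "norm (real (card (recip_set \<inter> {0..n})) / real (n + 1) - 1 / 3) =
        \<bar>real (card (recip_set \<inter> {0..n})) - real (n + 1) / 3\<bar> / real (n + 1)"
      by (simp only: real_norm_def abs_divide abs_of_nat)
    also have "\<dots> \<le> (4 + log 2 (real (n + 1))) / real (n + 1)"
      using card_recip_set_bound by (rule divide_right_mono) simp
    also have "\<dots> \<le> norm ((4 + log 2 (real (n + 1))) / real (n + 1)) * 1"
      by simp
    finally show ?thesis .
  qed
  then show "\<forall>\<^sub>F n in sequentially.
      norm (real (card (recip_set \<inter> {0..n})) / real (n + 1) - 1 / 3)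
      \<le> norm ((4 + log 2 (real (n + 1))) / real (n + 1)) * 1"
    by simp
qed

theorem theorem7p1:
  shows "reciprocal even_ones_set =
           {0} \<union> {n. \<exists>k\<ge>1. even (trailing_zeros k) \<and> (n = 4 * k - 1 \<or> n = 4 * k + 1)} \<and>
         has_density (reciprocal even_ones_set) (1 / 3)"
  using reciprocal_even_ones_set has_density_recip_set by (simp add: recip_set_def)

end
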